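(* Let $X_1,\dots,X_n$ be an i.i.d. sample from a continuous distribution function $F_X$, with order statistics $X_{(1)}\le\cdots\le X_{(n)}$, and let $U_{(i)}=F_X(X_{(i)})$. For each $i\in\{1,\dots,n\}$, the choice $p_i^A=\mathrm{Med}\{\mathrm{Beta}(i,n+1-i)\}$ is the best strategy for player A in Game (1), in the sense that with this choice, for every $p_i^B\in[0,1]$ with $p_i^B\ne p_i^A$, $$P\{|U_{(i)}-p_i^A|<|U_{(i)}-p_i^B|\}>\frac12 .$$
   Context: $\mathrm{Beta}(\alpha,\beta)$ is the distribution on $[0,1]$ with density $\frac{\Gamma(\alpha+\beta)}{\Gamma(\alpha)\Gamma(\beta)}x^{\alpha-1}(1-x)^{\beta-1}$, and $\mathrm{Med}$ denotes its median. Game (1): two players A and B choose plotting positions $p_i^A,p_i^B\in[0,1]$ for $U_{(i)}$. When the true distribution is revealed, A wins if $|U_{(i)}-p_i^A|<|U_{(i)}-p_i^B|$, in which case B pays one dollar to A; otherwise A pays one dollar to B. *)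

theory Defs
  imports "HOL-Probability.Probability"
begin

text \<open>
  Since \<open>0 powr 0 = 0\<close> in HOL, the value at an endpoint can differ from the usual one when
  \<open>a = 1\<close> or \<open>b = 1\<close>; this affects only a null set, hence not the distribution.
\<close>

definition beta_density :: "real \<Rightarrow> real \<Rightarrow> real \<Rightarrow> real" where
  "beta_density a b x =
     (if x \<in> {0..1}
      then Gamma (a + b) / (Gamma a * Gamma b) * x powr (a - 1) * (1 - x) powr (b - 1)
      else 0)"

definition beta_distribution :: "real \<Rightarrow> real \<Rightarrow> real measure" where
  "beta_distribution a b = density lborel (\<lambda>x. ennreal (beta_density a b x))"

definition is_median :: "real measure \<Rightarrow> real \<Rightarrow> bool" where
  "is_median M m \<longleftrightarrow> measure M {..m} \<ge> 1 / 2 \<and> measure M {m..} \<ge> 1 / 2"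

text \<open>Meaningful only for distributions with exactly one median.\<close>

definition Med :: "real measure \<Rightarrow> real" where
  "Med M = (THE m. is_median M m)"

text \<open>
  The sample is \<open>X 1, \<dots>, X n\<close>, and \<open>order_statistic n X k\<close> is the \<open>k\<close>-th smallest observation
  (ties counted with multiplicity), for \<open>k\<close> in \<open>{1..n}\<close>.
\<close>

definition order_statistic :: "nat \<Rightarrow> (nat \<Rightarrow> 'a \<Rightarrow> real) \<Rightarrow> nat \<Rightarrow> 'a \<Rightarrow> real" where
  "order_statistic n X k \<omega> = sort (map (\<lambda>j. X j \<omega>) [1..<n + 1]) ! (k - 1)"

text \<open>
  The game for the random quantity \<open>U\<close>: player A announces \<open>pA\<close>, player B announces \<open>pB\<close>,
  and a tie goes to B.
\<close>

definition A_wins :: "'a measure \<Rightarrow> ('a \<Rightarrow> real) \<Rightarrow> real \<Rightarrow> real \<Rightarrow> 'a set" where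
  "A_wins M U pA pB = {\<omega> \<in> space M. \<bar>U \<omega> - pA\<bar> < \<bar>U \<omega> - pB\<bar>}"

definition best_strategy_A :: "'a measure \<Rightarrow> ('a \<Rightarrow> real) \<Rightarrow> real \<Rightarrow> bool" where
  "best_strategy_A M U pA \<longleftrightarrow>
     pA \<in> {0..1} \<and> (\<forall>pB\<in>{0..1}. pB \<noteq> pA \<longrightarrow> measure M (A_wins M U pA pB) > 1 / 2)"

end

theory Submission imports Defs
begin

text \<open>
  If player A announces the median \<open>m\<close> of \<open>U\<close> and player B a point \<open>q > m\<close>, then A wins as soon as
  \<open>U\<close> lies to the left of the midpoint \<open>c = (m + q) / 2\<close>. As \<open>c > m\<close>, the probability of this is at
  least \<open>1 / 2\<close>, and it is strictly larger if the distribution function of \<open>U\<close> is continuous and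
  strictly increasing on \<open>{0..1}\<close>. The case \<open>q < m\<close> is the mirror image. This is
  \<open>best_strategy_Med\<close>.

  It remains to see that \<open>U = F (X\<^bsub>(i)\<^esub>)\<close> has the law \<open>Beta(i, n + 1 - i)\<close>
  (\<open>distr_cdf_order_statistic\<close>). Since \<open>F\<close> is monotone, \<open>U \<le> u\<close> holds iff at least \<open>i\<close> of the
  independent events \<open>F (X j) \<le> u\<close> occur, and each of these has probability \<open>u\<close> by the
  probability integral transform (\<open>prob_cdf_le\<close>). Hence the distribution function of \<open>U\<close> on
  \<open>{0..1}\<close> is the binomial tail \<open>\<Sum>k=i..n. (n choose k) * u ^ k * (1 - u) ^ (n - k)\<close>. The derivative
  of this sum telescopes to the beta density (\<open>binomial_tail_deriv\<close>), so the fundamental theorem of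
  calculus identifies it with the distribution function of the beta law (\<open>cdf_beta\<close>). The same
  derivative is positive inside the interval, which gives the strict monotonicity needed for the
  first part.
\<close>

section \<open>The upper tail of the binomial distribution\<close>

definition binomial_tail :: "nat \<Rightarrow> nat \<Rightarrow> real \<Rightarrow> real" where
  "binomial_tail n i u = (\<Sum>k=i..n. real (n choose k) * u ^ k * (1 - u) ^ (n - k))"

lemma binomial_tail_Suc:
  assumes "i \<le> n"
  shows "binomial_tail n i u =
           real (n choose i) * u ^ i * (1 - u) ^ (n - i) + binomial_tail n (Suc i) u"
  unfolding binomial_tail_def using assms by (simp add: sum.atLeast_Suc_atMost)

lemma binomial_tail_0: "1 \<le> i \<Longrightarrow> binomial_tail n i 0 = 0"
  unfolding binomial_tail_def by (intro sum.neutral) (auto simp: power_0_left)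

lemma binomial_tail_1:
  assumes "i \<le> n"
  shows "binomial_tail n i 1 = 1"
proof -
  have "binomial_tail n i 1 = (\<Sum>k\<in>{i..n}. if k = n then 1 else 0)"
    unfolding binomial_tail_def by (intro sum.cong) (auto simp: power_0_left)
  also have "\<dots> = 1" using assms by simp
  finally show ?thesis .
qed

text \<open>
  Differentiating the summand for \<open>k\<close> by the product rule gives a difference of two terms that are
  consecutive in \<open>k\<close>, by the absorption laws \<open>k * (n choose k) = n * ((n - 1) choose (k - 1))\<close> and
  \<open>(n - k) * (n choose k) = n * ((n - 1) choose k)\<close>. The sum therefore telescopes and only the term
  for \<open>k = i\<close> survives. The induction runs downwards from the empty sum at \<open>i = n + 1\<close>.
\<close>

lemma binomial_tail_deriv:
  assumes "1 \<le> i" "i \<le> n + 1" "1 \<le> n"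
  shows "(binomial_tail n i has_real_derivative
            real n * real ((n - 1) choose (i - 1)) * u ^ (i - 1) * (1 - u) ^ (n - i)) (at u)"
  using assms(2,1)
proof (induction i rule: inc_induct)
  case base
  have "binomial_tail n (n + 1) = (\<lambda>_. 0)" by (auto simp: binomial_tail_def)
  then show ?case using assms(3) by (simp add: binomial_eq_0)
next
  case (step i)
  then have i: "1 \<le> i" "i \<le> n" by auto
  have 1: "real i * real (n choose i) = real n * real ((n - 1) choose (i - 1))"
    using times_binomial_minus1_eq[of i n] i by (metis of_nat_mult less_eq_Suc_le One_nat_def)
  have 2: "real (n - i) * real (n choose i) = real n * real ((n - 1) choose i)"
    by (metis of_nat_mult binomial_absorb_comp)
  let ?c = "real (n choose i)"
  let ?T = "?c * (real i * u ^ (i - 1) * (1 - u) ^ (n - i)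
                    - u ^ i * (real (n - i) * (1 - u) ^ (n - i - 1)))"
  let ?R = "real n * real ((n - 1) choose i) * u ^ i * (1 - u) ^ (n - i - 1)"
  have "((\<lambda>u. ?c * u ^ i * (1 - u) ^ (n - i)) has_real_derivative ?T) (at u)"
    by (auto intro!: derivative_eq_intros simp: algebra_simps)
  moreover have "(binomial_tail n (Suc i) has_real_derivative ?R) (at u)"
    using step.IH by simp
  ultimately have "(binomial_tail n i has_real_derivative ?T + ?R) (at u)"
    using i by (subst (1) ext[OF binomial_tail_Suc]) (auto intro: DERIV_add)
  moreover have "?T + ?R = (real i * ?c) * u ^ (i - 1) * (1 - u) ^ (n - i)
      - (real (n - i) * ?c) * u ^ i * (1 - u) ^ (n - i - 1) + ?R"
    by (simp add: algebra_simps)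
  ultimately show ?case unfolding 1 2 by simp
qed

lemma binomial_tail_strict_mono:
  assumes "1 \<le> i" "i \<le> n"
  shows "strict_mono_on {0..1} (binomial_tail n i)"
proof (rule strict_mono_onI)
  fix r s :: real assume rs: "r \<in> {0..1}" "s \<in> {0..1}" "r < s"
  show "binomial_tail n i r < binomial_tail n i s"
  proof (rule DERIV_pos_imp_increasing_open[OF rs(3)])
    fix x assume "r < x" "x < s"
    then have "0 < real n * real ((n - 1) choose (i - 1)) * x ^ (i - 1) * (1 - x) ^ (n - i)"
      using assms rs by auto
    then show "\<exists>y. (binomial_tail n i has_real_derivative y) (at x) \<and> 0 < y"
      using binomial_tail_deriv[of i n x] assms by auto
  next
    show "continuous_on {r..s} (binomial_tail n i)"
      unfolding binomial_tail_def by (intro continuous_intros)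
  qed
qed

section \<open>The beta distribution with integer parameters\<close>

lemma beta_density_eq_deriv:
  assumes "1 \<le> i" "i \<le> n" "0 < x" "x < 1"
  shows "beta_density (real i) (real n + 1 - real i) x =
           real n * real ((n - 1) choose (i - 1)) * x ^ (i - 1) * (1 - x) ^ (n - i)"
proof -
  have G: "Gamma (real k) = fact (k - 1)" if "1 \<le> k" for k
    using Gamma_fact[of "k - 1", where 'a = real] that by (simp add: of_nat_diff)
  have b: "real n + 1 - real i = real (n + 1 - i)" using assms by (simp add: of_nat_diff)
  have ab: "real i + (real n + 1 - real i) = real (n + 1)" by simp
  have e: "real i - 1 = real (i - 1)" "real n + 1 - real i - 1 = real (n - i)"
    using assms by (simp_all add: of_nat_diff)
  have "Gamma (real (n + 1)) / (Gamma (real i) * Gamma (real (n + 1 - i)))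
          = fact n / (fact (i - 1) * fact (n - i))"
    using assms by (subst G, simp)+ simp
  also have "\<dots> = real n * real ((n - 1) choose (i - 1))"
    using assms by (simp add: binomial_fact fact_reduce[of n])
  finally show ?thesis
    using assms unfolding beta_density_def ab e b[symmetric]
    by (simp add: powr_realpow del: of_nat_diff of_nat_Suc of_nat_add)
qed

text \<open>
  A set is described here by its trace on \<open>{0..1}\<close>, so that one application of the fundamental
  theorem of calculus yields both the values of the distribution function and, with \<open>A = UNIV\<close>, the
  total mass.
\<close>

lemma emeasure_beta:
  assumes "1 \<le> i" "i \<le> n" "0 \<le> x" "x \<le> 1" and A: "A \<in> sets borel" "A \<inter> {0..1} = {0..x}"
  shows "emeasure (beta_distribution (real i) (real n + 1 - real i)) A = binomial_tail n i x"
proof -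
  let ?f = "beta_density (real i) (real n + 1 - real i)"
  let ?p = "\<lambda>u. real n * real ((n - 1) choose (i - 1)) * u ^ (i - 1) * (1 - u) ^ (n - i)"
  have m: "?f \<in> borel_measurable borel" unfolding beta_density_def by measurable
  have "emeasure (beta_distribution (real i) (real n + 1 - real i)) A
          = (\<integral>\<^sup>+u. ennreal (?f u) * indicator A u \<partial>lborel)"
    unfolding beta_distribution_def using A m by (subst emeasure_density) auto
  also have "\<dots> = (\<integral>\<^sup>+u. ennreal (?p u) * indicator {0..x} u \<partial>lborel)"
  proof (rule nn_integral_cong_AE)
    \<comment> \<open>The density and the polynomial may disagree at the endpoints, where
      \<open>0 powr 0 = 0\<close> but \<open>0 ^ 0 = 1\<close>.\<close>
    have "AE u in lborel. u \<noteq> (0::real)" "AE u in lborel. u \<noteq> (1::real)"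
      by (rule AE_lborel_singleton)+
    then show "AE u in lborel.
        ennreal (?f u) * indicator A u = ennreal (?p u) * indicator {0..x} u"
    proof eventually_elim
      case (elim u)
      show ?case
      proof (cases "0 < u \<and> u < 1")
        case True
        then have "u \<in> A \<longleftrightarrow> u \<in> {0..x}" using A(2) by (metis IntD1 IntI atLeastAtMost_iff less_imp_le)
        then show ?thesis using True assms by (simp add: beta_density_eq_deriv indicator_def)
      next
        case False
        then have "u \<notin> {0..1}" using elim by auto
        then show ?thesis using assms by (auto simp: beta_density_def indicator_def)
      qed
    qed
  qed
  also have "\<dots> = ennreal (binomial_tail n i x - binomial_tail n i 0)"
    using assms by (intro nn_integral_FTC_Icc binomial_tail_deriv
        DERIV_subset[OF binomial_tail_deriv]) (auto intro!: mult_nonneg_nonneg)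
  finally show ?thesis using assms by (simp add: binomial_tail_0)
qed

lemma real_distribution_beta:
  assumes "1 \<le> i" "i \<le> n"
  shows "real_distribution (beta_distribution (real i) (real n + 1 - real i))"
proof -
  have "emeasure (beta_distribution (real i) (real n + 1 - real i)) UNIV = 1"
    using emeasure_beta[OF assms, of 1 UNIV] assms by (simp add: binomial_tail_1)
  then show ?thesis
    unfolding real_distribution_def real_distribution_axioms_def
    by (auto intro!: prob_spaceI simp: beta_distribution_def)
qed

lemma beta_atomless: "measure (beta_distribution a b) {x} = 0"
proof -
  have "beta_density a b \<in> borel_measurable borel" unfolding beta_density_def by measurable
  moreover have "AE u in lborel. u \<in> {x} \<longrightarrow> ennreal (beta_density a b u) = 0"
    using AE_lborel_singleton[of x] by eventually_elim auto
  ultimately have "{x} \<in> null_sets (beta_distribution a b)"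
    unfolding beta_distribution_def by (subst null_sets_density_iff; (intro conjI)?; (assumption | simp))
  then show ?thesis by (rule measure_eq_0_null_sets)
qed

lemma cdf_beta:
  assumes "1 \<le> i" "i \<le> n" "0 \<le> x" "x \<le> 1"
  shows "cdf (beta_distribution (real i) (real n + 1 - real i)) x = binomial_tail n i x"
proof -
  have "0 \<le> binomial_tail n i x" unfolding binomial_tail_def using assms by (intro sum_nonneg) auto
  moreover have "{..x} \<inter> {0..1} = {0..x}" using assms by auto
  ultimately show ?thesis
    using emeasure_beta[OF assms, of "{..x}"] by (simp add: cdf_def measure_def)
qed

section \<open>Order statistics and counting\<close>

text \<open>
  On a sorted list the elements satisfying a downward closed predicate form a prefix, and sorting
  does not change how many of them there are.
\<close>

lemma nth_sort_iff_count:
  fixes xs :: "'b::linorder list"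
  assumes "\<And>x y. P y \<Longrightarrow> x \<le> y \<Longrightarrow> P x" "k < length xs"
  shows "P (sort xs ! k) \<longleftrightarrow> k < length (filter P xs)"
proof -
  have *: "P (ys ! k) \<longleftrightarrow> k < length (filter P ys)" if "sorted ys" "k < length ys" for ys k
    using that
  proof (induction ys arbitrary: k)
    case (Cons y ys)
    show ?case
    proof (cases "P y")
      case True
      with Cons show ?thesis by (cases k) auto
    next
      case False
      then have n: "\<not> P z" if "z \<in> set (y # ys)" for z
        using Cons.prems(1) assms(1)[of z y] that by auto
      then have "filter P (y # ys) = []" by (meson filter_False)
      then show ?thesis using n[OF nth_mem[OF Cons.prems(2)]] by simp
    qed
  qed simp
  have "mset (filter P (sort xs)) = mset (filter P xs)" by simp
  then have "length (filter P (sort xs)) = length (filter P xs)" by (metis size_mset)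
  with *[of "sort xs" k] assms(2) show ?thesis by simp
qed

text \<open>
  Allowing any downward closed predicate makes this applicable to \<open>\<lambda>x. F x \<le> u\<close> directly, without
  commuting \<open>F\<close> with sorting and without inverting \<open>F\<close>, which may have flat pieces.
\<close>

lemma order_statistic_iff_count:
  assumes "\<And>x y. P y \<Longrightarrow> x \<le> y \<Longrightarrow> P x" "i \<in> {1..n}"
  shows "P (order_statistic n X i \<omega>) \<longleftrightarrow> i \<le> card {j \<in> {1..n}. P (X j \<omega>)}"
proof -
  have "length (filter P (map (\<lambda>j. X j \<omega>) [1..<n + 1]))
          = card (set (filter (\<lambda>j. P (X j \<omega>)) [1..<n + 1]))"
    by (subst distinct_card) (auto simp: filter_map o_def)
  also have "set (filter (\<lambda>j. P (X j \<omega>)) [1..<n + 1]) = {j \<in> {1..n}. P (X j \<omega>)}" by auto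
  finally show ?thesis
    unfolding order_statistic_def using assms
    by (subst nth_sort_iff_count[of P]) (auto simp del: upt_Suc)
qed

context prob_space begin

text \<open>
  The event is the disjoint union, over the \<open>k\<close>-element sets \<open>S\<close>, of the events that exactly the
  indices in \<open>S\<close> succeed. Each of these is a finite intersection of independent events.
\<close>

lemma prob_count_eq_binomial:
  assumes X: "indep_vars N X I" and I: "finite I" "I \<noteq> {}"
    and A: "\<And>j. j \<in> I \<Longrightarrow> A j \<in> sets (N j)"
    and p: "\<And>j. j \<in> I \<Longrightarrow> prob (X j -` A j \<inter> space M) = p"
  shows "prob {\<omega> \<in> space M. card {j \<in> I. X j \<omega> \<in> A j} = k}
           = real (card I choose k) * p ^ k * (1 - p) ^ (card I - k)"
    and "{\<omega> \<in> space M. card {j \<in> I. X j \<omega> \<in> A j} = k} \<in> events"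
proof -
  define E where "E S = {\<omega> \<in> space M. {j \<in> I. X j \<omega> \<in> A j} = S}" for S
  define B where "B S j = (if j \<in> S then A j else space (N j) - A j)" for S j
  let ?K = "{S. S \<subseteq> I \<and> card S = k}"
  have rv: "X j \<in> measurable M (N j)" if "j \<in> I" for j
    using X that unfolding indep_vars_def by blast
  have E: "E S = (\<Inter>j\<in>I. X j -` B S j \<inter> space M)" if "S \<subseteq> I" for S
    using that I(2) rv[THEN measurable_space] by (auto simp: E_def B_def split: if_splits)
  have B: "B S j \<in> sets (N j)" if "j \<in> I" for S j using A that by (auto simp: B_def)
  have meas: "E S \<in> events" if "S \<subseteq> I" for S
    unfolding E[OF that] using I B rv by (intro sets.finite_INT measurable_sets) auto
  have PE: "prob (E S) = p ^ k * (1 - p) ^ (card I - k)" if S: "S \<in> ?K" for S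
  proof -
    have fS: "finite S" using S I finite_subset by auto
    have c: "prob (X j -` B S j \<inter> space M) = (if j \<in> S then p else 1 - p)" if "j \<in> I" for j
    proof -
      have "X j -` (space (N j) - A j) \<inter> space M = space M - (X j -` A j \<inter> space M)"
        using rv[OF that, THEN measurable_space] by auto
      then show ?thesis
        using prob_compl[of "X j -` A j \<inter> space M"] p[OF that] measurable_sets[OF rv A] that
        by (simp add: B_def)
    qed
    have "prob (E S) = prob (\<Inter>j\<in>I. X j -` B S j \<inter> space M)" using S by (simp add: E)
    also have "\<dots> = (\<Prod>j\<in>I. prob (X j -` B S j \<inter> space M))"
      by (rule indep_varsD_finite[OF X I(2,1) B])
    also have "\<dots> = (\<Prod>j\<in>I. if j \<in> S then p else 1 - p)" using c by (intro prod.cong) auto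
    also have "\<dots> = (\<Prod>j\<in>S. p) * (\<Prod>j\<in>I - S. 1 - p)"
      using S I by (subst prod.If_cases) (auto simp: Int_absorb1 Diff_eq)
    also have "\<dots> = p ^ k * (1 - p) ^ (card I - k)"
      using S fS by (simp add: card_Diff_subset)
    finally show ?thesis .
  qed
  have union: "{\<omega> \<in> space M. card {j \<in> I. X j \<omega> \<in> A j} = k} = (\<Union>S\<in>?K. E S)"
    by (auto simp: E_def)
  then show "{\<omega> \<in> space M. card {j \<in> I. X j \<omega> \<in> A j} = k} \<in> events"
    using I meas by auto
  have "prob (\<Union>S\<in>?K. E S) = (\<Sum>S\<in>?K. prob (E S))"
    using I meas by (intro finite_measure_finite_Union) (auto simp: disjoint_family_on_def E_def)
  then show "prob {\<omega> \<in> space M. card {j \<in> I. X j \<omega> \<in> A j} = k}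
      = real (card I choose k) * p ^ k * (1 - p) ^ (card I - k)"
    using PE n_subsets[OF I(1), of k] unfolding union by simp
qed

lemma prob_count_ge_binomial_tail:
  assumes X: "indep_vars N X I" and I: "finite I" "I \<noteq> {}"
    and A: "\<And>j. j \<in> I \<Longrightarrow> A j \<in> sets (N j)"
    and p: "\<And>j. j \<in> I \<Longrightarrow> prob (X j -` A j \<inter> space M) = p"
  shows "prob {\<omega> \<in> space M. i \<le> card {j \<in> I. X j \<omega> \<in> A j}} = binomial_tail (card I) i p"
    and "{\<omega> \<in> space M. i \<le> card {j \<in> I. X j \<omega> \<in> A j}} \<in> events"
proof -
  let ?C = "\<lambda>k. {\<omega> \<in> space M. card {j \<in> I. X j \<omega> \<in> A j} = k}"
  have meas: "?C k \<in> events" for k by (rule prob_count_eq_binomial(2)[OF X I A p])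
  have union: "{\<omega> \<in> space M. i \<le> card {j \<in> I. X j \<omega> \<in> A j}} = (\<Union>k\<in>{i..card I}. ?C k)"
    using I(1) by (auto intro!: card_mono)
  show "{\<omega> \<in> space M. i \<le> card {j \<in> I. X j \<omega> \<in> A j}} \<in> events"
    using meas unfolding union by auto
  have "prob (\<Union>k\<in>{i..card I}. ?C k) = (\<Sum>k\<in>{i..card I}. prob (?C k))"
    using meas by (intro finite_measure_finite_Union) (auto simp: disjoint_family_on_def)
  then show "prob {\<omega> \<in> space M. i \<le> card {j \<in> I. X j \<omega> \<in> A j}} = binomial_tail (card I) i p"
    using prob_count_eq_binomial(1)[OF X I A p] unfolding union by (simp add: binomial_tail_def)
qed

end

section \<open>The probability integral transform\<close>

context real_distribution begin

lemma exists_cdf_eq: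
  assumes "continuous_on UNIV (cdf M)" "0 < u" "u < 1"
  obtains x where "cdf M x = u"
proof -
  have "eventually (\<lambda>x. cdf M x < u) at_bot" "eventually (\<lambda>x. u < cdf M x) at_top"
    using order_tendstoD[OF cdf_lim_at_bot] order_tendstoD[OF cdf_lim_at_top_prob] assms by auto
  then obtain a b where "\<And>x. x \<le> a \<Longrightarrow> cdf M x < u" "\<And>x. b \<le> x \<Longrightarrow> u < cdf M x"
    unfolding eventually_at_bot_linorder eventually_at_top_linorder by blast
  then have "cdf M (min a b) \<le> u" "u \<le> cdf M (max a b)"
    by (meson less_imp_le min.cobounded1 max.cobounded2)+
  then have "\<exists>x. min a b \<le> x \<and> x \<le> max a b \<and> cdf M x = u"
    using assms(1) by (intro IVT') (auto intro: continuous_on_subset)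
  then show ?thesis using that by blast
qed

text \<open>
  Write \<open>F\<close> for \<open>cdf M\<close>. If \<open>F y = v\<close>, then \<open>{x. F x \<le> u}\<close> is contained in \<open>{..y}\<close> for \<open>u < v\<close> and contains \<open>{..y}\<close> for
  \<open>u = v\<close>. By continuity every value in the open unit interval is attained, so letting \<open>v\<close> decrease
  to \<open>u\<close> determines the probability.
\<close>

lemma prob_cdf_le:
  assumes c: "continuous_on UNIV (cdf M)" and u: "0 \<le> u" "u \<le> 1"
  shows "prob {x. cdf M x \<le> u} = u"
proof (rule antisym)
  have [measurable]: "cdf M \<in> borel_measurable borel"
    using c by (rule borel_measurable_continuous_onI)
  have meas: "{x. cdf M x \<le> u} \<in> events" by simp
  show "prob {x. cdf M x \<le> u} \<le> u"
  proof (rule dense_ge)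
    fix v assume "u < v"
    show "prob {x. cdf M x \<le> u} \<le> v"
    proof (cases "v < 1")
      case True
      then obtain y where y: "cdf M y = v" using exists_cdf_eq[OF c, of v] \<open>u < v\<close> u by auto
      have "x \<le> y" if "cdf M x \<le> u" for x
        using cdf_nondecreasing[of y x] that y \<open>u < v\<close> by (cases "x \<le> y") auto
      then have "prob {x. cdf M x \<le> u} \<le> prob {..y}" by (intro finite_measure_mono) auto
      then show ?thesis using y by (simp add: cdf_def)
    qed (use prob_le_1[of "{x. cdf M x \<le> u}"] in linarith)
  qed
  show "u \<le> prob {x. cdf M x \<le> u}"
  proof -
    consider "u = 0" | "u = 1" | "0 < u" "u < 1" using u by linarith
    then show ?thesis
    proof cases
      case 2
      then show ?thesis using prob_space cdf_bounded_prob by simp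
    next
      case 3
      then obtain y where y: "cdf M y = u" using exists_cdf_eq[OF c] by auto
      have "prob {..y} \<le> prob {x. cdf M x \<le> u}"
        using cdf_nondecreasing y meas by (intro finite_measure_mono) auto
      then show ?thesis using y by (simp add: cdf_def)
    qed simp
  qed
qed

end

section \<open>The median as a winning strategy\<close>

context real_distribution begin

lemma measure_lessThan_atomless: "prob {x} = 0 \<Longrightarrow> prob {..<x} = cdf M x"
proof -
  assume "prob {x} = 0"
  moreover have "prob ({..<x} \<union> {x}) = prob {..<x} + prob {x}"
    by (intro finite_measure_Union) auto
  moreover have "{..<x} \<union> {x} = {..x}" by auto
  ultimately show ?thesis by (simp add: cdf_def)
qed

lemma is_median_iff_cdf:
  assumes "prob {m} = 0"
  shows "is_median M m \<longleftrightarrow> cdf M m = 1 / 2"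
proof -
  have "prob {m..} = 1 - prob {..<m}"
    using prob_compl[of "{..<m}"] by (simp add: Compl_eq_Diff_UNIV[symmetric] Compl_lessThan)
  then show ?thesis
    using measure_lessThan_atomless[OF assms] by (auto simp: is_median_def cdf_def)
qed

text \<open>
  A median exists by the intermediate value theorem and is unique by strict monotonicity, so the
  definite description in \<open>Med\<close> denotes it.
\<close>

lemma Med_atomless:
  assumes atom: "\<And>x. prob {x} = 0" and mono: "strict_mono_on {0..1} (cdf M)"
    and "cdf M 0 = 0" "cdf M 1 = 1"
  shows "Med M \<in> {0..1}" "cdf M (Med M) = 1 / 2"
proof -
  have "\<forall>x. isCont (cdf M) x" using atom isCont_cdf by simp
  then obtain m where m: "0 \<le> m" "m \<le> 1" "cdf M m = 1 / 2"
    using IVT[of "cdf M" 0 "1 / 2" 1] assms by auto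
  have "m' = m" if "cdf M m' = 1 / 2" for m'
  proof -
    have "m' \<in> {0..1}"
      using that assms cdf_nondecreasing[of m' 0] cdf_nondecreasing[of 1 m'] by fastforce
    then show ?thesis
      using strict_mono_on_eqD[OF mono, of m' m] m that by auto
  qed
  then have "Med M = m"
    unfolding Med_def is_median_iff_cdf[OF atom] using m(3) by (intro the_equality)
  with m show "Med M \<in> {0..1}" "cdf M (Med M) = 1 / 2" by auto
qed

end

text \<open>
  The points closer to \<open>m\<close> than to \<open>q\<close> are those on the same side of the midpoint as \<open>m\<close>. This
  half-line has mass greater than \<open>1 / 2\<close>, because the mass strictly between \<open>m\<close> and the midpoint is
  positive.
\<close>

lemma (in prob_space) best_strategy_Med:
  assumes U: "random_variable borel U"
    and atom: "\<And>x. measure (distr M borel U) {x} = 0"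
    and mono: "strict_mono_on {0..1} (cdf (distr M borel U))"
    and "cdf (distr M borel U) 0 = 0" "cdf (distr M borel U) 1 = 1"
  shows "best_strategy_A M U (Med (distr M borel U))"
proof -
  define D where "D = distr M borel U"
  interpret D: real_distribution D unfolding D_def using U by simp
  define m where "m = Med D"
  have m: "m \<in> {0..1}" "cdf D m = 1 / 2"
    using D.Med_atomless assms unfolding D_def m_def by auto
  have wins: "measure M (A_wins M U m q) = D.prob {x. \<bar>x - m\<bar> < \<bar>x - q\<bar>}" for q
    unfolding D_def A_wins_def using U
    by (subst measure_distr) (auto intro!: arg_cong[where f = "measure M"])
  have "1 / 2 < measure M (A_wins M U m q)" if q: "q \<in> {0..1}" "q \<noteq> m" for q
  proof -
    define c where "c = (m + q) / 2"
    have c: "c \<in> {0..1}" using m q by (auto simp: c_def)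
    have lt: "D.prob {..<c} = cdf D c"
      using D.measure_lessThan_atomless atom by (simp add: D_def)
    have "1 / 2 < D.prob {x. \<bar>x - m\<bar> < \<bar>x - q\<bar>}"
    proof (cases "m < q")
      case True
      then have "1 / 2 < cdf D c"
        using strict_mono_onD[OF mono, of m c] m c by (simp add: D_def c_def)
      moreover have "D.prob {..<c} \<le> D.prob {x. \<bar>x - m\<bar> < \<bar>x - q\<bar>}"
        using True by (intro D.finite_measure_mono) (auto simp: c_def abs_if field_simps)
      ultimately show ?thesis using lt by simp
    next
      case False
      then have "cdf D c < 1 / 2"
        using strict_mono_onD[OF mono, of c m] m c q by (simp add: D_def c_def)
      moreover have "D.prob {c<..} = 1 - cdf D c"
        using D.prob_compl[of "{..c}"]
        by (simp add: Compl_eq_Diff_UNIV[symmetric] Compl_atMost cdf_def)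
      moreover have "D.prob {c<..} \<le> D.prob {x. \<bar>x - m\<bar> < \<bar>x - q\<bar>}"
        using False q by (intro D.finite_measure_mono) (auto simp: c_def abs_if field_simps)
      ultimately show ?thesis by simp
    qed
    then show ?thesis using wins by simp
  qed
  then show ?thesis using m unfolding best_strategy_A_def m_def D_def by blast
qed

section \<open>The distribution of the transformed order statistics\<close>

text \<open>
  The two laws have the same distribution function: on \<open>{0..1}\<close> it is the binomial tail for both, and
  outside the interval both are constant because \<open>F\<close> takes values in \<open>{0..1}\<close>. Counting also gives
  the measurability of the transformed order statistic.
\<close>

lemma (in prob_space) distr_cdf_order_statistic:
  assumes X: "indep_vars (\<lambda>_. borel) X {1..n}"
    and F: "\<And>j. j \<in> {1..n} \<Longrightarrow> cdf (distr M borel (X j)) = F"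
    and c: "continuous_on UNIV F"
    and i: "i \<in> {1..n}"
  shows "random_variable borel (\<lambda>\<omega>. F (order_statistic n X i \<omega>))"
    and "distr M borel (\<lambda>\<omega>. F (order_statistic n X i \<omega>))
           = beta_distribution (real i) (real n + 1 - real i)"
proof -
  define U where "U = (\<lambda>\<omega>. F (order_statistic n X i \<omega>))"
  have rv: "random_variable borel (X j)" if "j \<in> {1..n}" for j
    using X that unfolding indep_vars_def by blast
  interpret L: real_distribution "distr M borel (X i)" using rv[OF i] by simp
  have Fi: "cdf (distr M borel (X i)) = F" using F i .
  have mono: "F x \<le> F y" if "x \<le> y" for x y using L.cdf_nondecreasing[OF that] by (simp add: Fi)
  have F0: "0 \<le> F x" and F1: "F x \<le> 1" for x
    using L.cdf_nonneg[of x] L.cdf_bounded_prob[of x] by (auto simp: Fi)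
  have [measurable]: "F \<in> borel_measurable borel"
    using c by (rule borel_measurable_continuous_onI)
  have unif: "prob (X j -` {x. F x \<le> u} \<inter> space M) = u"
    if "j \<in> {1..n}" "0 \<le> u" "u \<le> 1" for j u
  proof -
    interpret Lj: real_distribution "distr M borel (X j)" using rv that by simp
    show ?thesis using Lj.prob_cdf_le[of u] that c F rv by (simp add: measure_distr)
  qed
  have count: "{\<omega> \<in> space M. U \<omega> \<le> u}
      = {\<omega> \<in> space M. i \<le> card {j \<in> {1..n}. X j \<omega> \<in> {x. F x \<le> u}}}" for u
  proof -
    have "F x \<le> u" if "F y \<le> u" "x \<le> y" for x y using mono[OF that(2)] that(1) by simp
    from order_statistic_iff_count[of "\<lambda>x. F x \<le> u", OF this i, where X = X] show ?thesis
      by (simp add: U_def)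
  qed
  have tail: "prob {\<omega> \<in> space M. U \<omega> \<le> u} = binomial_tail n i u"
    and meas: "{\<omega> \<in> space M. U \<omega> \<le> u} \<in> events" if "0 \<le> u" "u \<le> 1" for u
  proof -
    have ne: "{1..n} \<noteq> {}" using i by auto
    have A: "{x. F x \<le> u} \<in> sets borel" by measurable
    note T = prob_count_ge_binomial_tail[OF X finite_atLeastAtMost ne A unif[OF _ that], of i]
    show "prob {\<omega> \<in> space M. U \<omega> \<le> u} = binomial_tail n i u"
      unfolding count using T(1) by (simp only: card_atLeastAtMost diff_Suc_1)
    show "{\<omega> \<in> space M. U \<omega> \<le> u} \<in> events"
      unfolding count by (rule T(2))
  qed
  have neg: "{\<omega> \<in> space M. U \<omega> \<le> u} = {}" if "u < 0" for u
    using that by (auto simp: U_def not_le intro: less_le_trans[OF _ F0])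
  have big: "{\<omega> \<in> space M. U \<omega> \<le> u} = space M" if "1 < u" for u
    using that by (auto simp: U_def intro: order_trans[OF F1])
  have rvU: "random_variable borel U"
    unfolding borel_measurable_iff_le
  proof
    fix u show "{\<omega> \<in> space M. U \<omega> \<le> u} \<in> events"
      using meas[of u] neg[of u] big[of u] by (metis linorder_not_less sets.empty_sets sets.top)
  qed
  then show "random_variable borel (\<lambda>\<omega>. F (order_statistic n X i \<omega>))" by (simp add: U_def)
  have n: "1 \<le> i" "i \<le> n" using i by auto
  define B where "B = beta_distribution (real i) (real n + 1 - real i)"
  interpret B: real_distribution B unfolding B_def by (rule real_distribution_beta[OF n])
  have cdfU: "cdf (distr M borel U) u = prob {\<omega> \<in> space M. U \<omega> \<le> u}" for u
    using rvU by (simp add: cdf_def measure_distr vimage_def Int_def conj_commute)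
  have "cdf (distr M borel U) u = cdf B u" for u
  proof -
    have cB: "cdf B u = binomial_tail n i u" if "0 \<le> u" "u \<le> 1" for u
      unfolding B_def using cdf_beta[OF n that] .
    consider "u < 0" | "1 < u" | "0 \<le> u" "u \<le> 1" by linarith
    then show ?thesis
    proof cases
      case 1
      then have "cdf B u = 0"
        using B.cdf_nondecreasing[of u 0] B.cdf_nonneg[of u] cB[of 0] n
        by (simp add: binomial_tail_0)
      then show ?thesis unfolding cdfU neg[OF 1] by simp
    next
      case 2
      then have "cdf B u = 1"
        using B.cdf_nondecreasing[of 1 u] B.cdf_bounded_prob[of u] cB[of 1] n
        by (simp add: binomial_tail_1)
      then show ?thesis unfolding cdfU big[OF 2] by (simp add: prob_space)
    next
      case 3
      then show ?thesis using tail cB by (simp add: cdfU)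
    qed
  qed
  then have "distr M borel U = B"
    using rvU B.real_distribution_axioms by (intro cdf_unique ext) auto
  then show "distr M borel (\<lambda>\<omega>. F (order_statistic n X i \<omega>))
           = beta_distribution (real i) (real n + 1 - real i)"
    by (simp add: U_def B_def)
qed

theorem theorem2p3:
  fixes M :: "'a measure" and X :: "nat \<Rightarrow> 'a \<Rightarrow> real" and F :: "real \<Rightarrow> real" and n i :: nat
  assumes "prob_space M"
    and "prob_space.indep_vars M (\<lambda>_. borel) X {1..n}"
    and "\<And>j. j \<in> {1..n} \<Longrightarrow> cdf (distr M borel (X j)) = F"
    and "continuous_on UNIV F"
    and "i \<in> {1..n}"
  shows "best_strategy_A M (\<lambda>\<omega>. F (order_statistic n X i \<omega>))
           (Med (beta_distribution (real i) (real n + 1 - real i)))"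
proof -
  interpret prob_space M by fact
  have n: "1 \<le> i" "i \<le> n" using assms(5) by auto
  let ?B = "beta_distribution (real i) (real n + 1 - real i)"
  let ?U = "\<lambda>\<omega>. F (order_statistic n X i \<omega>)"
  have U: "random_variable borel ?U" and law: "distr M borel ?U = ?B"
    using distr_cdf_order_statistic[OF assms(2) _ assms(4,5)] assms(3) by auto
  have "strict_mono_on {0..1} (cdf ?B)"
    using binomial_tail_strict_mono[OF n] cdf_beta[OF n] by (simp add: strict_mono_on_def)
  moreover have "cdf ?B 0 = 0" "cdf ?B 1 = 1"
    using cdf_beta[OF n] n by (simp_all add: binomial_tail_0 binomial_tail_1)
  ultimately show ?thesis
    using best_strategy_Med[OF U] beta_atomless unfolding law by blast
qed

end
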